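(* Consider the parallel-links routing game with homogeneous costs described in the context, with exactly $N=2$ users. Then $PoS=1$. Moreover, the NBS cost vector $\tilde{\mathbf g}$ is the cost vector $(J^1(\bar{\mathbf f}),J^2(\bar{\mathbf f}))$ of a single feasible routing profile $\bar{\mathbf f}$ whose link totals equal the system-optimal link flows, so that the NBS outcome is socially optimal with probability $1$.
   Context: Parallel-links routing game: users $\mathcal N=\{1,\dots,N\}$ share parallel links $\mathcal L=\{1,\dots,L\}$ joining a common source to a common destination; link $l$ has capacity $c_l$. User $i$ has demand $r^i>0$, $R=\sum_i r^i$, and $\sum_l c_l>R$. A routing strategy of user $i$ is $\mathbf f^i=(f^i_1,\dots,f^i_L)$ with $f^i_l\ge 0$ and $\sum_l f^i_l=r^i$; a feasible profile is $\mathbf f=(\mathbf f^1,\dots,\mathbf f^N)$ (set $\mathbf F$), and $f_l=\sum_i f^i_l$. Homogeneous costs: $J^i(\mathbf f)=\sum_{l} f^i_l T_l(f_l)$, where each $T_l:[0,\infty)\to[0,\infty)$ is strictly increasing, convex and continuously differentiable, and $T_l(f_l)=T(c_l-f_l)$ if $f_l<c_l$, $T_l(f_l)=\infty$ if $f_l\ge c_l$, for a single function $T$ not depending on the link, with $T(c_l-f_l)$ strictly increasing in $f_l$. NEP: a feasible $\hat{\mathbf f}$ such that each $\hat{\mathbf f}^i$ minimizes $J^i$ over user $i$'s feasible strategies given the others' strategies; it exists and is unique. $\hat J^i=J^i(\hat{\mathbf f})$, $\hat{\mathbf J}=(\hat J^i)_i$. Social cost $J_{sys}(\mathbf f)=\sum_iJ^i(\mathbf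 f)=\sum_l f_lT_l(f_l)$, depending only on link totals; $J^*_{sys}$ is its minimum over $\mathbf F$, attained at system-optimal link flows $(f^*_l)_l$. Bargaining: $\mathcal G$ is the set of all vectors $\sum_{m=1}^M p_m\,(J^1(\mathbf f(m)),\dots,J^N(\mathbf f(m)))$ with $M$ finite, $p_m>0$, $\sum_m p_m=1$, $\mathbf f(m)\in\mathbf F$. The NBS is the unique $\tilde{\mathbf g}$ maximizing $\prod_i(\hat J^i-g^i)$ over $\mathbf g\in\mathcal G$ with $g^i\le\hat J^i$ for all $i$. $PoS=\big(\sum_i\tilde g^i\big)/J^*_{sys}$. *)

theory Defs
  imports "HOL-Analysis.Analysis"
begin

text \<open>Parallel-links routing game with N = 2 users (indexed 1, 2) and
  links indexed 1..L.  A profile is f :: nat => nat => real, f i l = flow of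
  user i on link l.  Costs are extended reals (infinite when a link is
  saturated).\<close>

definition Tl :: "(real \<Rightarrow> real) \<Rightarrow> real \<Rightarrow> real \<Rightarrow> ereal" where
  "Tl T cl x = (if x < cl then ereal (T (cl - x)) else \<infinity>)"

definition strategy :: "nat \<Rightarrow> (nat \<Rightarrow> real) \<Rightarrow> nat \<Rightarrow> (nat \<Rightarrow> real) \<Rightarrow> bool" where
  "strategy L r i fi \<longleftrightarrow> (\<forall>l\<in>{1..L}. fi l \<ge> 0) \<and> (\<Sum>l=1..L. fi l) = r i"

definition feasible :: "nat \<Rightarrow> (nat \<Rightarrow> real) \<Rightarrow> (nat \<Rightarrow> nat \<Rightarrow> real) \<Rightarrow> bool" where
  "feasible L r f \<longleftrightarrow> (\<forall>i\<in>{1,2::nat}. strategy L r i (f i))"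

definition tot :: "(nat \<Rightarrow> nat \<Rightarrow> real) \<Rightarrow> nat \<Rightarrow> real" where
  "tot f l = f 1 l + f 2 l"

definition cost :: "nat \<Rightarrow> (nat \<Rightarrow> real) \<Rightarrow> (real \<Rightarrow> real) \<Rightarrow> (nat \<Rightarrow> nat \<Rightarrow> real) \<Rightarrow> nat \<Rightarrow> ereal" where
  "cost L c T f i = (\<Sum>l=1..L. ereal (f i l) * Tl T (c l) (tot f l))"

definition sys_cost :: "nat \<Rightarrow> (nat \<Rightarrow> real) \<Rightarrow> (real \<Rightarrow> real) \<Rightarrow> (nat \<Rightarrow> nat \<Rightarrow> real) \<Rightarrow> ereal" where
  "sys_cost L c T f = cost L c T f 1 + cost L c T f 2"

definition is_NEP :: "nat \<Rightarrow> (nat \<Rightarrow> real) \<Rightarrow> (nat \<Rightarrow> real) \<Rightarrow> (real \<Rightarrow> real) \<Rightarrow> (nat \<Rightarrow> nat \<Rightarrow> real) \<Rightarrow> bool" where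
  "is_NEP L r c T f \<longleftrightarrow> feasible L r f \<and>
     (\<forall>i\<in>{1,2::nat}. \<forall>g. strategy L r i g \<longrightarrow> cost L c T f i \<le> cost L c T (f(i := g)) i)"

definition Jstar :: "nat \<Rightarrow> (nat \<Rightarrow> real) \<Rightarrow> (nat \<Rightarrow> real) \<Rightarrow> (real \<Rightarrow> real) \<Rightarrow> ereal" where
  "Jstar L r c T = Inf {sys_cost L c T f | f. feasible L r f}"

definition is_sys_opt :: "nat \<Rightarrow> (nat \<Rightarrow> real) \<Rightarrow> (nat \<Rightarrow> real) \<Rightarrow> (real \<Rightarrow> real) \<Rightarrow> (nat \<Rightarrow> nat \<Rightarrow> real) \<Rightarrow> bool" where
  "is_sys_opt L r c T f \<longleftrightarrow> feasible L r f \<and>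
     (\<forall>f'. feasible L r f' \<longrightarrow> sys_cost L c T f \<le> sys_cost L c T f')"

definition bargset :: "nat \<Rightarrow> (nat \<Rightarrow> real) \<Rightarrow> (nat \<Rightarrow> real) \<Rightarrow> (real \<Rightarrow> real) \<Rightarrow> (nat \<Rightarrow> ereal) set" where
  "bargset L r c T = {g. \<exists>(M::nat) (p::nat \<Rightarrow> real) (fs::nat \<Rightarrow> nat \<Rightarrow> nat \<Rightarrow> real).
      M \<ge> 1 \<and> (\<forall>m<M. p m > 0 \<and> feasible L r (fs m)) \<and> (\<Sum>m<M. p m) = 1 \<and>
      g = (\<lambda>i. \<Sum>m<M. ereal (p m) * cost L c T (fs m) i)}"

definition is_NBS :: "(nat \<Rightarrow> ereal) set \<Rightarrow> (nat \<Rightarrow> ereal) \<Rightarrow> (nat \<Rightarrow> ereal) \<Rightarrow> bool" where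
  "is_NBS G Jhat g \<longleftrightarrow> g \<in> G \<and> (\<forall>i\<in>{1,2::nat}. g i \<le> Jhat i) \<and>
     (\<forall>g'\<in>G. (\<forall>i\<in>{1,2::nat}. g' i \<le> Jhat i) \<longrightarrow>
        (Jhat 1 - g' 1) * (Jhat 2 - g' 2) \<le> (Jhat 1 - g 1) * (Jhat 2 - g 2))"

definition PoS :: "(nat \<Rightarrow> ereal) \<Rightarrow> ereal \<Rightarrow> ereal" where
  "PoS g Js = (g 1 + g 2) / Js"

end

theory Submission
  imports Defs
begin

text \<open>
  Let \<open>x\<close> be any vector of link totals of finite cost. Moving flow towards links on which \<open>x\<close> is
  below the equilibrium flow of user \<open>i\<close>, and away from links on which \<open>x\<close> exceeds the equilibrium
  total, does not increase the social cost: by convexity the change is at most the change in the cost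
  of user \<open>i\<close> under the opposite deviation from the equilibrium. So one may assume that \<open>x\<close> dominates
  both equilibrium strategies. Letting one user keep the equilibrium strategy and the other route the
  remainder of \<open>x\<close> is then a unilateral deviation, hence does not profit the deviator, and the whole
  surplus goes to the user who stays. Mixing the two such profiles divides the surplus equally, so
  that by AM-GM the NBS has total cost at most that of \<open>x\<close>. Thus every profile in the support of the
  NBS is socially optimal; by strict convexity they all have the same link totals, and for fixed
  totals the costs are linear, so that averaging these profiles yields a single one.
\<close>

section \<open>Increments of convex functions, products and weighted averages\<close>

text \<open>Both \<open>a + u\<close> and \<open>b\<close> are convex combinations of
  \<open>a\<close> and \<open>b + u\<close>, with the two weights interchanged. Adding the two
  convexity inequalities gives the claim.\<close>

lemma convex_on_increment_mono:
  fixes f :: "real \<Rightarrow> real"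
  assumes f: "convex_on S f" and S: "a \<in> S" "b + u \<in> S" and ab: "a \<le> b" and u: "0 \<le> u"
  shows "f (a + u) - f a \<le> f (b + u) - f b"
proof (cases "b - a + u = 0")
  case True
  then have "u = 0" using ab u by linarith
  then show ?thesis by simp
next
  case False
  define d t where "d = b - a + u" and "t = u / d"
  have d: "d > 0" using False ab u unfolding d_def by linarith
  have t: "0 \<le> t" "t \<le> 1" using d ab u unfolding t_def d_def by (auto simp: divide_simps)
  have td: "t * d = u" using d unfolding t_def by simp
  have bu: "b + u = a + d" unfolding d_def by simp
  have "f ((1 - t) *\<^sub>R a + t *\<^sub>R (b + u)) \<le> (1 - t) * f a + t * f (b + u)"
    using convex_onD[OF f t(1) t(2) S] .
  moreover have "(1 - t) *\<^sub>R a + t *\<^sub>R (b + u) = a + u"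
    unfolding bu using td by (simp add: algebra_simps)
  ultimately have 1: "f (a + u) \<le> (1 - t) * f a + t * f (b + u)" by simp
  have "f ((1 - (1 - t)) *\<^sub>R a + (1 - t) *\<^sub>R (b + u)) \<le> (1 - (1 - t)) * f a + (1 - t) * f (b + u)"
    using t S by (intro convex_onD[OF f]) auto
  moreover have "(1 - (1 - t)) *\<^sub>R a + (1 - t) *\<^sub>R (b + u) = b"
    unfolding bu using td bu by (simp add: algebra_simps)
  ultimately have 2: "f b \<le> t * f a + (1 - t) * f (b + u)" by simp
  from 1 2 show ?thesis by (simp add: algebra_simps)
qed

text \<open>The hypothesis gives \<open>s\<^sup>2 \<le> 4 * a * b \<le> (a + b)\<^sup>2\<close>. It
  turns a lower bound on a Nash product into one on the total gain.\<close>

lemma amgm_half: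
  fixes a b s :: real
  assumes "0 \<le> a" "0 \<le> b" "(s / 2) * (s / 2) \<le> a * b"
  shows "s \<le> a + b"
proof -
  have "0 \<le> (a - b)\<^sup>2" by simp
  then have "s\<^sup>2 \<le> (a + b)\<^sup>2" using assms(3) by (simp add: power2_eq_square algebra_simps)
  then show ?thesis using assms(1,2) by (meson add_nonneg_nonneg power2_le_imp_le)
qed

text \<open>The nonnegative numbers \<open>p m * (X m - b)\<close> sum to zero, so each of them
  vanishes.\<close>

lemma weighted_average_eq_lower_bound:
  fixes p X :: "nat \<Rightarrow> real"
  assumes p: "\<And>m. m < M \<Longrightarrow> 0 < p m" "(\<Sum>m<M. p m) = 1"
    and X: "\<And>m. m < M \<Longrightarrow> b \<le> X m" "(\<Sum>m<M. p m * X m) = b" and m: "m < M"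
  shows "X m = b"
proof -
  have "(\<Sum>m<M. p m * (X m - b)) = (\<Sum>m<M. p m * X m) - (\<Sum>m<M. p m) * b"
    by (simp add: algebra_simps sum_subtractf sum_distrib_left)
  also have "\<dots> = 0" using p X by simp
  finally have "\<forall>m\<in>{..<M}. p m * (X m - b) = 0"
    using p(1) X(1) by (subst (asm) sum_nonneg_eq_0_iff) (auto simp: less_imp_le)
  then have "p m * (X m - b) = 0" using m by blast
  then show ?thesis using p(1)[OF m] by simp
qed

section \<open>Finite costs, link totals and social cost\<close>

locale parallel_links =
  fixes L :: nat and c r :: "nat \<Rightarrow> real" and T :: "real \<Rightarrow> real"
  assumes r_pos: "i \<in> {1,2} \<Longrightarrow> 0 < r i"
    and cap: "r 1 + r 2 < (\<Sum>l=1..L. c l)"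
    and T_nonneg: "\<lbrakk>l \<in> {1..L}; 0 \<le> x; x < c l\<rbrakk> \<Longrightarrow> 0 \<le> T (c l - x)"
    and T_mono: "l \<in> {1..L} \<Longrightarrow> strict_mono_on {0..<c l} (\<lambda>x. T (c l - x))"
    and T_convex: "l \<in> {1..L} \<Longrightarrow> convex_on {0..<c l} (\<lambda>x. T (c l - x))"
begin

text \<open>The alternative \<open>x l = 0\<close> covers links without capacity: no sign of \<open>c l\<close> is assumed, and the
  infinite cost of an unused link counts as \<open>0\<close>.\<close>

definition finite_totals :: "(nat \<Rightarrow> real) \<Rightarrow> bool" where
  "finite_totals x \<longleftrightarrow> (\<forall>l\<in>{1..L}. 0 \<le> x l \<and> (x l < c l \<or> x l = 0)) \<and> (\<Sum>l=1..L. x l) = r 1 + r 2"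

text \<open>Real counterpart of \<open>sys_cost\<close> for totals satisfying
  \<open>finite_totals\<close>. For these, \<open>x l\<close> is zero wherever
  \<open>c l \<le> x l\<close>, so the value of \<open>T\<close> there does not matter.\<close>

definition total_cost :: "(nat \<Rightarrow> real) \<Rightarrow> real" where
  "total_cost x = (\<Sum>l=1..L. x l * T (c l - x l))"

definition real_cost :: "(nat \<Rightarrow> nat \<Rightarrow> real) \<Rightarrow> nat \<Rightarrow> real" where
  "real_cost f i = (\<Sum>l=1..L. f i l * T (c l - tot f l))"

lemma feasible_nonneg: "\<lbrakk>feasible L r f; i \<in> {1,2}; l \<in> {1..L}\<rbrakk> \<Longrightarrow> 0 \<le> f i l"
  unfolding feasible_def strategy_def by blast

lemma feasible_sum: "\<lbrakk>feasible L r f; i \<in> {1,2}\<rbrakk> \<Longrightarrow> (\<Sum>l=1..L. f i l) = r i"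
  unfolding feasible_def strategy_def by blast

lemma feasible_le_tot: "\<lbrakk>feasible L r f; i \<in> {1,2}; l \<in> {1..L}\<rbrakk> \<Longrightarrow> f i l \<le> tot f l"
  using feasible_nonneg[of f 1 l] feasible_nonneg[of f 2 l] by (auto simp: tot_def)

lemma feasible_tot_nonneg: "\<lbrakk>feasible L r f; l \<in> {1..L}\<rbrakk> \<Longrightarrow> 0 \<le> tot f l"
  using feasible_nonneg[of f 1 l] feasible_nonneg[of f 2 l] by (auto simp: tot_def)

lemma feasible_sum_tot: "feasible L r f \<Longrightarrow> (\<Sum>l=1..L. tot f l) = r 1 + r 2"
  using feasible_sum[of f 1] feasible_sum[of f 2] by (simp add: tot_def sum.distrib)

lemma T_increment_mono:
  assumes "l \<in> {1..L}" "0 \<le> a" "a \<le> b" "0 \<le> u" "b + u < c l"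
  shows "T (c l - (a + u)) - T (c l - a) \<le> T (c l - (b + u)) - T (c l - b)"
  using convex_on_increment_mono[OF T_convex[OF assms(1)], of a b u] assms by auto

lemma T_le:
  assumes "l \<in> {1..L}" "0 \<le> a" "a \<le> b" "b < c l"
  shows "T (c l - a) \<le> T (c l - b)"
  using strict_mono_onD[OF T_mono[OF assms(1)], of a b] assms by (cases "a = b") auto

lemma T_less:
  assumes "l \<in> {1..L}" "0 \<le> a" "a < b" "b < c l"
  shows "T (c l - a) < T (c l - b)"
  using strict_mono_onD[OF T_mono[OF assms(1)], of a b] assms by auto

lemma cost_term_nonneg:
  assumes "feasible L r f" "i \<in> {1,2}" "l \<in> {1..L}"
  shows "0 \<le> ereal (f i l) * Tl T (c l) (tot f l)"
  using feasible_nonneg[OF assms] feasible_tot_nonneg[OF assms(1,3)] T_nonneg[OF assms(3)]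
  by (auto simp: Tl_def)

lemma cost_nonneg: "\<lbrakk>feasible L r f; i \<in> {1,2}\<rbrakk> \<Longrightarrow> 0 \<le> cost L c T f i"
  unfolding cost_def by (intro sum_nonneg cost_term_nonneg)

text \<open>A link whose total is not below capacity has total zero, hence no flow of user
  \<open>i\<close>, and \<open>0 * \<infinity> = 0\<close> in \<open>ereal\<close>.\<close>

lemma cost_eq_real_cost:
  assumes f: "feasible L r f" "finite_totals (tot f)" and i: "i \<in> {1,2}"
  shows "cost L c T f i = ereal (real_cost f i)"
proof -
  have "ereal (f i l) * Tl T (c l) (tot f l) = ereal (f i l * T (c l - tot f l))"
    if l: "l \<in> {1..L}" for l
  proof (cases "tot f l < c l")
    case False
    then have "tot f l = 0" using f(2) l unfolding finite_totals_def by blast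
    then have "f i l = 0" using feasible_nonneg[OF f(1) i l] feasible_le_tot[OF f(1) i l] by simp
    then show ?thesis by (simp add: zero_ereal_def[symmetric])
  qed (simp add: Tl_def)
  then show ?thesis unfolding cost_def real_cost_def by (simp add: sum_ereal[symmetric] del: sum_ereal)
qed

text \<open>All summands are nonnegative, so the sum is infinite only through one infinite summand.
  That takes positive own flow on a saturated link; a link saturated by the other user alone costs
  nothing.\<close>

lemma cost_finite_iff:
  assumes f: "feasible L r f" and i: "i \<in> {1,2}"
  shows "cost L c T f i \<noteq> \<infinity> \<longleftrightarrow> (\<forall>l\<in>{1..L}. f i l = 0 \<or> tot f l < c l)"
  using feasible_nonneg[OF f i]
  by (auto simp: cost_def sum_Pinfty Tl_def less_le split: if_splits)

lemma finite_totals_iff: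
  assumes f: "feasible L r f"
  shows "finite_totals (tot f) \<longleftrightarrow> cost L c T f 1 \<noteq> \<infinity> \<and> cost L c T f 2 \<noteq> \<infinity>"
proof -
  have "tot f l = 0 \<longleftrightarrow> f 1 l = 0 \<and> f 2 l = 0" if "l \<in> {1..L}" for l
    using feasible_nonneg[OF f, of 1 l] feasible_nonneg[OF f, of 2 l] that by (auto simp: tot_def)
  then show ?thesis
    using feasible_tot_nonneg[OF f] feasible_sum_tot[OF f] cost_finite_iff[OF f, of 1]
      cost_finite_iff[OF f, of 2] unfolding finite_totals_def by auto
qed

lemma real_cost_add: "real_cost f 1 + real_cost f 2 = total_cost (tot f)"
  by (simp add: real_cost_def total_cost_def tot_def sum.distrib[symmetric] distrib_right)

lemma sys_cost_eq_total_cost: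
  assumes "feasible L r f" "finite_totals (tot f)"
  shows "sys_cost L c T f = ereal (total_cost (tot f))"
  using cost_eq_real_cost[OF assms, of 1] cost_eq_real_cost[OF assms, of 2] real_cost_add[of f]
  by (simp add: sys_cost_def)

lemma sys_cost_infinite:
  assumes "feasible L r f" "\<not> finite_totals (tot f)"
  shows "sys_cost L c T f = \<infinity>"
  using assms finite_totals_iff[OF assms(1)] cost_nonneg[OF assms(1), of 1] cost_nonneg[OF assms(1), of 2]
  by (auto simp: sys_cost_def)

lemma total_cost_cong: "(\<And>l. l \<in> {1..L} \<Longrightarrow> x l = y l) \<Longrightarrow> total_cost x = total_cost y"
  by (simp add: total_cost_def)

text \<open>Some link carries flow, and there \<open>T\<close> exceeds its nonnegative value at zero
  flow by strict monotonicity. This keeps the denominator of \<open>PoS\<close> away from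
  zero.\<close>

lemma total_cost_pos:
  assumes x: "finite_totals x"
  shows "0 < total_cost x"
proof -
  have "0 < (\<Sum>l=1..L. x l)" using x r_pos[of 1] r_pos[of 2] by (simp add: finite_totals_def)
  then obtain k where k: "k \<in> {1..L}" "0 < x k" by (meson not_le sum_nonpos)
  then have "x k < c k" using x unfolding finite_totals_def by fastforce
  then have "0 < T (c k - x k)" using T_nonneg[of k 0] T_less[of k 0 "x k"] k by fastforce
  moreover have "0 \<le> x l * T (c l - x l)" if "l \<in> {1..L}" for l
    using x that T_nonneg[of l "x l"] unfolding finite_totals_def by fastforce
  ultimately show ?thesis
    unfolding total_cost_def using k by (intro sum_pos2[of _ k]) auto
qed

section \<open>Strict convexity and uniqueness of the optimal totals\<close>

text \<open>Convexity of the link costs bounds the cost at the midpoint by a product of two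
  averages. That product falls short of the average of the products by a term that is positive where
  \<open>x\<close> and \<open>y\<close> differ, by strict monotonicity.\<close>

lemma total_cost_midpoint_less:
  assumes x: "finite_totals x" and y: "finite_totals y" and k: "k \<in> {1..L}" "x k \<noteq> y k"
  defines "z \<equiv> \<lambda>l. (x l + y l) / 2"
  shows "finite_totals z" "total_cost z < (total_cost x + total_cost y) / 2"
proof -
  \<comment> \<open>Both totals are below \<open>c l\<close> if it is positive, and both vanish
    otherwise.\<close>
  have both: "0 \<le> x l \<and> 0 \<le> y l \<and> (x l < c l \<and> y l < c l \<or> x l = 0 \<and> y l = 0)"
    if "l \<in> {1..L}" for l
    using x y that unfolding finite_totals_def by force
  have "(\<Sum>l=1..L. z l) = ((\<Sum>l=1..L. x l) + (\<Sum>l=1..L. y l)) / 2"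
    by (simp add: z_def sum.distrib[symmetric] sum_divide_distrib[symmetric])
  then show "finite_totals z"
    using x y both unfolding finite_totals_def z_def by fastforce
  have gap: "z l * T (c l - z l) \<le>
      (x l * T (c l - x l) + y l * T (c l - y l)) / 2 - (x l - y l) * (T (c l - x l) - T (c l - y l)) / 4"
    if l: "l \<in> {1..L}" for l
  proof (cases "x l = 0 \<and> y l = 0")
    case True
    then show ?thesis by (simp add: z_def)
  next
    case False
    then have *: "x l \<in> {0..<c l}" "y l \<in> {0..<c l}" using both[OF l] by auto
    have "T (c l - z l) \<le> (T (c l - x l) + T (c l - y l)) / 2"
      using convex_onD[OF T_convex[OF l], of "1/2", OF _ _ *]
      by (simp add: z_def add_divide_distrib)
    then have "z l * T (c l - z l) \<le> z l * ((T (c l - x l) + T (c l - y l)) / 2)"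
      using * by (intro mult_left_mono) (auto simp: z_def)
    also have "\<dots> = (x l * T (c l - x l) + y l * T (c l - y l)) / 2
        - (x l - y l) * (T (c l - x l) - T (c l - y l)) / 4"
      by (simp add: z_def field_simps)
    finally show ?thesis .
  qed
  have pos: "0 < (x l - y l) * (T (c l - x l) - T (c l - y l))"
    if "l \<in> {1..L}" "x l \<noteq> y l" for l
    using both[OF that(1)] that T_less[OF that(1), of "x l" "y l"] T_less[OF that(1), of "y l" "x l"]
    by (cases "x l < y l") (auto intro: mult_pos_pos mult_neg_neg)
  have nonneg: "0 \<le> (x l - y l) * (T (c l - x l) - T (c l - y l))" if "l \<in> {1..L}" for l
    using pos[OF that] by (cases "x l = y l") auto
  have "total_cost z < (\<Sum>l=1..L. (x l * T (c l - x l) + y l * T (c l - y l)) / 2)"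
    unfolding total_cost_def
  proof (rule sum_strict_mono_ex1)
    show "\<forall>l\<in>{1..L}. z l * T (c l - z l) \<le> (x l * T (c l - x l) + y l * T (c l - y l)) / 2"
    proof
      fix l assume l: "l \<in> {1..L}"
      show "z l * T (c l - z l) \<le> (x l * T (c l - x l) + y l * T (c l - y l)) / 2"
        using gap[OF l] nonneg[OF l] by linarith
    qed
    show "\<exists>l\<in>{1..L}. z l * T (c l - z l) < (x l * T (c l - x l) + y l * T (c l - y l)) / 2"
      using gap[OF k(1)] pos[OF k] k(1) by (intro bexI[of _ k]) linarith+
  qed simp
  then show "total_cost z < (total_cost x + total_cost y) / 2"
    by (simp add: total_cost_def sum.distrib sum_divide_distrib add_divide_distrib)
qed

text \<open>On every link the total is split in proportion to the demands.\<close>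

lemma finite_totals_realizable:
  assumes x: "finite_totals x"
  obtains f where "feasible L r f" "tot f = x"
proof
  define f where "f = (\<lambda>i l. r i / (r 1 + r 2) * x l)"
  have R: "0 < r 1" "0 < r 2" using r_pos by auto
  have "(\<Sum>l=1..L. f i l) = r i" for i
    using x R unfolding f_def sum_distrib_left[symmetric] finite_totals_def by simp
  then show "feasible L r f"
    using x R by (auto simp: feasible_def strategy_def f_def finite_totals_def)
  have "tot f l = (r 1 / (r 1 + r 2) + r 2 / (r 1 + r 2)) * x l" for l
    by (simp only: tot_def f_def distrib_right)
  moreover have "r 1 / (r 1 + r 2) + r 2 / (r 1 + r 2) = 1" using R by (simp add: add_divide_distrib[symmetric])
  ultimately show "tot f = x" by auto
qed

text \<open>If the totals of two optima differed, a profile realizing their midpoint would be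
  strictly cheaper. Finiteness passes from \<open>f\<close> to \<open>h\<close> because their social
  costs agree.\<close>

lemma is_sys_opt_tot_unique:
  assumes f: "is_sys_opt L r c T f" "finite_totals (tot f)"
    and h: "is_sys_opt L r c T h" and k: "k \<in> {1..L}"
  shows "tot f k = tot h k"
proof (rule ccontr)
  assume ne: "tot f k \<noteq> tot h k"
  have feas: "feasible L r f" "feasible L r h" using f h by (auto simp: is_sys_opt_def)
  have le: "sys_cost L c T h \<le> sys_cost L c T f" "sys_cost L c T f \<le> sys_cost L c T h"
    using f h feas by (auto simp: is_sys_opt_def)
  have fin: "finite_totals (tot h)"
    using le(1) sys_cost_infinite[OF feas(2)] sys_cost_eq_total_cost[OF feas(1) f(2)] by fastforce
  have eq: "total_cost (tot f) = total_cost (tot h)"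
    using le sys_cost_eq_total_cost[OF feas(1) f(2)] sys_cost_eq_total_cost[OF feas(2) fin] by simp
  note mid = total_cost_midpoint_less[OF f(2) fin k ne]
  obtain q where q: "feasible L r q" "tot q = (\<lambda>l. (tot f l + tot h l) / 2)"
    using finite_totals_realizable[OF mid(1)] by blast
  have "sys_cost L c T f \<le> sys_cost L c T q" using f(1) q(1) by (simp add: is_sys_opt_def)
  then show False
    using mid eq sys_cost_eq_total_cost[OF q(1)] q(2) sys_cost_eq_total_cost[OF feas(1) f(2)] by simp
qed

section \<open>Averages of profiles and responses of finite cost\<close>

text \<open>With common totals the link costs \<open>T (c l - x l)\<close> are constants, so the
  cost of each user is linear in the profile.\<close>

lemma average_profile:
  fixes p :: "nat \<Rightarrow> real"
  assumes p: "\<And>m. m < M \<Longrightarrow> 0 \<le> p m" "(\<Sum>m<M. p m) = 1"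
    and fs: "\<And>m. m < M \<Longrightarrow> feasible L r (fs m)"
    and x: "\<And>m l. m < M \<Longrightarrow> l \<in> {1..L} \<Longrightarrow> tot (fs m) l = x l"
  defines "f \<equiv> \<lambda>i l. \<Sum>m<M. p m * fs m i l"
  shows "feasible L r f" and "l \<in> {1..L} \<Longrightarrow> tot f l = x l"
    and "real_cost f i = (\<Sum>m<M. p m * real_cost (fs m) i)"
proof -
  have "(\<Sum>l=1..L. f i l) = r i" if "i \<in> {1,2}" for i
  proof -
    have "(\<Sum>l=1..L. f i l) = (\<Sum>m<M. p m * (\<Sum>l=1..L. fs m i l))"
      unfolding f_def sum_distrib_left by (rule sum.swap)
    also have "\<dots> = (\<Sum>m<M. p m * r i)" using feasible_sum[OF fs that] by simp
    finally show ?thesis using p(2) by (simp add: sum_distrib_right[symmetric])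
  qed
  moreover have "0 \<le> f i l" if "i \<in> {1,2}" "l \<in> {1..L}" for i l
    unfolding f_def using p(1) feasible_nonneg[OF fs that] by (intro sum_nonneg) simp
  ultimately show "feasible L r f" by (simp add: feasible_def strategy_def)
  show tot_f: "tot f l = x l" if l: "l \<in> {1..L}" for l
  proof -
    have "tot f l = (\<Sum>m<M. p m * tot (fs m) l)"
      by (simp add: tot_def f_def sum.distrib distrib_left)
    also have "\<dots> = (\<Sum>m<M. p m * x l)" using x[OF _ l] by simp
    finally show ?thesis using p(2) by (simp add: sum_distrib_right[symmetric])
  qed
  have "real_cost f i = (\<Sum>l=1..L. \<Sum>m<M. p m * (fs m i l * T (c l - x l)))"
    unfolding real_cost_def
    by (intro sum.cong refl) (simp only: tot_f, simp add: f_def sum_distrib_right mult.assoc)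
  also have "\<dots> = (\<Sum>m<M. \<Sum>l=1..L. p m * (fs m i l * T (c l - x l)))" by (rule sum.swap)
  also have "\<dots> = (\<Sum>m<M. p m * real_cost (fs m) i)"
    by (simp add: real_cost_def x sum_distrib_left)
  finally show "real_cost f i = (\<Sum>m<M. p m * real_cost (fs m) i)" .
qed

text \<open>The capacity left by the other user sums to more than \<open>r i\<close>, so loading the
  links in proportion to it leaves every link that user \<open>i\<close> uses strictly below
  capacity.\<close>

lemma finite_response_exists:
  assumes f: "feasible L r f" and i: "i \<in> {1,2}"
  obtains h where "strategy L r i h" "cost L c T (f(i := h)) i \<noteq> \<infinity>"
proof -
  define j where "j = 3 - i"
  have ij: "j \<in> {1,2}" "i \<noteq> j" "r 1 + r 2 = r i + r j" using i by (auto simp: j_def)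
  have tot: "tot (f(i := h)) l = h l + f j l" for h l
    using i by (auto simp: tot_def j_def)
  \<comment> \<open>The truncation gives no flow to links that the other user already
    saturates.\<close>
  define \<rho> where "\<rho> l = max 0 (c l - f j l)" for l
  define s where "s = (\<Sum>l=1..L. \<rho> l)"
  have "(\<Sum>l=1..L. c l - f j l) \<le> s" unfolding s_def \<rho>_def by (intro sum_mono) auto
  then have s: "r i < s" using cap feasible_sum[OF f ij(1)] ij(3) by (simp add: sum_subtractf)
  have ri: "0 < r i" using r_pos i by blast
  define h where "h l = r i / s * \<rho> l" for l
  have "(\<Sum>l=1..L. h l) = r i"
    unfolding h_def sum_distrib_left[symmetric] s_def[symmetric] using s ri by simp
  then have h: "strategy L r i h"
    using s ri by (auto simp: strategy_def h_def \<rho>_def)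
  have lt: "h l + f j l < c l" if "h l \<noteq> 0" for l
  proof -
    have "0 < \<rho> l" using that unfolding h_def \<rho>_def by (auto simp: max_def split: if_splits)
    then have "h l < \<rho> l" using s ri unfolding h_def by (simp add: divide_simps)
    with \<open>0 < \<rho> l\<close> show ?thesis unfolding \<rho>_def by (auto simp: max_def split: if_splits)
  qed
  have "feasible L r (f(i := h))" using f h by (auto simp: feasible_def)
  then have "cost L c T (f(i := h)) i \<noteq> \<infinity>"
    using cost_finite_iff[of "f(i := h)" i] i lt tot by auto
  with h that show ?thesis by blast
qed

end

section \<open>Comparing arbitrary totals with the equilibrium\<close>

locale parallel_links_NEP = parallel_links +
  fixes fhat :: "nat \<Rightarrow> nat \<Rightarrow> real"
  assumes NEP: "is_NEP L r c T fhat"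
begin

lemma fhat_feasible: "feasible L r fhat"
  using NEP by (simp add: is_NEP_def)

text \<open>A user with infinite equilibrium cost could switch to a response of finite cost.\<close>

lemma fhat_finite: "finite_totals (tot fhat)"
proof -
  have "cost L c T fhat i \<noteq> \<infinity>" if i: "i \<in> {1,2}" for i
  proof -
    obtain h where h: "strategy L r i h" "cost L c T (fhat(i := h)) i \<noteq> \<infinity>"
      using finite_response_exists[OF fhat_feasible i] .
    have "cost L c T fhat i \<le> cost L c T (fhat(i := h)) i"
      using NEP i h(1) unfolding is_NEP_def by blast
    then show ?thesis using h(2) by auto
  qed
  then show ?thesis using finite_totals_iff[OF fhat_feasible] by simp
qed

lemma fhat_deviation:
  assumes i: "i \<in> {1,2}" and h: "strategy L r i h" and fin: "finite_totals (tot (fhat(i := h)))"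
  shows "feasible L r (fhat(i := h))" and "real_cost fhat i \<le> real_cost (fhat(i := h)) i"
proof -
  show feas: "feasible L r (fhat(i := h))" using fhat_feasible h by (auto simp: feasible_def)
  have "cost L c T fhat i \<le> cost L c T (fhat(i := h)) i"
    using NEP i h unfolding is_NEP_def by blast
  then show "real_cost fhat i \<le> real_cost (fhat(i := h)) i"
    using cost_eq_real_cost[OF fhat_feasible fhat_finite i] cost_eq_real_cost[OF feas fin i] by simp
qed

text \<open>The bound by \<open>min (x l) (tot fhat l)\<close> allows the lemma to be applied to one
  user after the other: domination of the first user's strategy survives the second
  application.\<close>

lemma raise_totals_to_fhat:
  assumes x: "finite_totals x" and i: "i \<in> {1,2}"
  shows "\<exists>z. finite_totals z \<and> total_cost z \<le> total_cost x \<and>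
    (\<forall>l\<in>{1..L}. fhat i l \<le> z l \<and> min (x l) (tot fhat l) \<le> z l)"
proof -
  define y where "y = tot fhat"
  have fi: "0 \<le> fhat i l" "fhat i l \<le> y l" if "l \<in> {1..L}" for l
    using feasible_nonneg[OF fhat_feasible i that] feasible_le_tot[OF fhat_feasible i that]
    by (auto simp: y_def)
  have both: "0 \<le> x l \<and> 0 \<le> y l \<and> (x l < c l \<and> y l < c l \<or> x l = 0 \<and> y l = 0)"
    if "l \<in> {1..L}" for l
    using x fhat_finite that unfolding finite_totals_def y_def by force
  \<comment> \<open>\<open>a\<close> is the shortfall of \<open>x\<close> below the flow of user
    \<open>i\<close>, and \<open>b\<close> its excess over the equilibrium totals. As
    \<open>x\<close> and \<open>y\<close> have equal sums, the excess suffices to fill the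
    shortfall.\<close>
  define a b where "a l = max 0 (fhat i l - x l)" and "b l = max 0 (x l - y l)" for l
  define A B where "A = (\<Sum>l=1..L. a l)" and "B = (\<Sum>l=1..L. b l)"
  have "A \<le> (\<Sum>l=1..L. b l - (x l - y l))"
    unfolding A_def by (intro sum_mono) (use fi in \<open>force simp: a_def b_def\<close>)
  also have "\<dots> = B"
    using x fhat_finite by (simp add: B_def sum_subtractf finite_totals_def y_def)
  finally have AB: "A \<le> B" .
  have A0: "0 \<le> A" unfolding A_def by (intro sum_nonneg) (simp add: a_def)
  \<comment> \<open>The fraction of the excess to be moved. If \<open>B\<close> is zero then so is
    \<open>A\<close>, and division by zero gives the right value \<open>0\<close>.\<close>
  define \<theta> where "\<theta> = A / B"
  have \<theta>: "0 \<le> \<theta>" "\<theta> \<le> 1" "\<theta> * B = A"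
    using AB A0 by (auto simp: \<theta>_def divide_simps)
  define d where "d l = a l - \<theta> * b l" for l
  have sum_d: "(\<Sum>l=1..L. d l) = 0"
    using \<theta>(3) by (simp add: d_def sum_subtractf sum_distrib_left[symmetric] A_def B_def)
  have cases: "(x l < fhat i l \<and> d l = fhat i l - x l) \<or>
      (fhat i l \<le> x l \<and> y l < x l \<and> d l \<le> 0 \<and> y l - x l \<le> d l) \<or> (fhat i l \<le> x l \<and> x l \<le> y l \<and> d l = 0)"
    if l: "l \<in> {1..L}" for l
  proof -
    have \<theta>_le: "\<theta> * (x l - y l) \<le> x l - y l" "0 \<le> \<theta> * (x l - y l)" if "y l < x l"
      using \<theta> that by (auto intro: mult_left_le_one_le)
    consider "x l < fhat i l" | "y l < x l" | "fhat i l \<le> x l" "x l \<le> y l" by linarith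
    then show ?thesis
    proof cases
      case 2
      then have "d l = - (\<theta> * (x l - y l))" using fi[OF l] by (simp add: d_def a_def b_def)
      then show ?thesis using 2 \<theta>_le fi[OF l] by linarith
    qed (use fi[OF l] in \<open>auto simp: d_def a_def b_def\<close>)
  qed
  \<comment> \<open>The same shift \<open>d\<close> is added to the totals \<open>x\<close> and
    subtracted from the strategy of user \<open>i\<close>. Since \<open>d\<close> has sum zero, both
    keep their sums.\<close>
  define z h where "z l = x l + d l" and "h l = fhat i l - d l" for l
  have "strategy L r i h"
    unfolding strategy_def
  proof (intro conjI ballI)
    show "(\<Sum>l=1..L. h l) = r i"
      using feasible_sum[OF fhat_feasible i] sum_d by (simp add: h_def sum_subtractf)
    fix l assume l: "l \<in> {1..L}"
    show "0 \<le> h l" using cases[OF l] both[OF l] fi[OF l] unfolding h_def by (elim disjE conjE; linarith)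
  qed
  moreover have tot_h: "tot (fhat(i := h)) l = y l - d l" for l
    using i by (auto simp: tot_def h_def y_def)
  have "finite_totals (\<lambda>l. y l - d l)"
    unfolding finite_totals_def
  proof (intro conjI ballI)
    show "(\<Sum>l=1..L. y l - d l) = r 1 + r 2"
      using sum_d fhat_finite by (simp add: sum_subtractf finite_totals_def y_def)
    fix l assume l: "l \<in> {1..L}"
    show "0 \<le> y l - d l" "y l - d l < c l \<or> y l - d l = 0"
      using cases[OF l] both[OF l] fi[OF l] by (elim disjE conjE; linarith)+
  qed
  then have "finite_totals (tot (fhat(i := h)))" using tot_h by presburger
  ultimately have dev: "real_cost fhat i \<le> real_cost (fhat(i := h)) i"
    using fhat_deviation(2)[OF i] by blast
  \<comment> \<open>Link by link, the change in social cost is at most what user \<open>i\<close>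
    saves by the deviation \<open>h\<close>; summed over the links, this saving is at most
    zero.\<close>
  have "z l * T (c l - z l) - x l * T (c l - x l) \<le>
      fhat i l * T (c l - y l) - h l * T (c l - (y l - d l))" if l: "l \<in> {1..L}" for l
    using cases[OF l]
  proof (elim disjE conjE)
    \<comment> \<open>Here \<open>s\<close> is the flow of the other user. The extra cost that
      \<open>s\<close> causes to an own flow grows with that flow, which rises from
      \<open>x l\<close> to \<open>fhat i l\<close>.\<close>
    assume *: "x l < fhat i l" "d l = fhat i l - x l"
    define s where "s = y l - fhat i l"
    have lt: "y l < c l" using * fi[OF l] both[OF l] by linarith
    have "T (c l - (x l + s)) - T (c l - x l) \<le> T (c l - (fhat i l + s)) - T (c l - fhat i l)"
      using * fi[OF l] both[OF l] lt by (intro T_increment_mono[OF l]) (auto simp: s_def)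
    moreover have "T (c l - x l) \<le> T (c l - (x l + s))"
      using * fi[OF l] both[OF l] lt by (intro T_le[OF l]) (auto simp: s_def)
    ultimately have gain: "x l * (T (c l - (x l + s)) - T (c l - x l)) \<le>
        fhat i l * (T (c l - (fhat i l + s)) - T (c l - fhat i l))"
      using * both[OF l] fi[OF l] by (intro mult_mono) auto
    have eqs: "x l + s = y l - d l" "fhat i l + s = y l" "z l = fhat i l" "h l = x l"
      using * by (auto simp: s_def z_def h_def)
    show ?thesis using gain unfolding eqs by (simp add: right_diff_distrib)
  next
    \<comment> \<open>Here \<open>u\<close> units leave the link in \<open>x\<close> and join it in
      the deviation. As \<open>fhat i l \<le> y l \<le> x l - u\<close>, the saving at the higher
      load is at least the additional cost at the lower one.\<close>
    assume *: "y l < x l" "d l \<le> 0" "y l - x l \<le> d l"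
    define u where "u = - d l"
    have lt: "x l < c l" using * both[OF l] by linarith
    have u: "0 \<le> u" "y l \<le> x l - u" using * by (auto simp: u_def)
    have "T (c l - (y l + u)) - T (c l - y l) \<le> T (c l - (x l - u + u)) - T (c l - (x l - u))"
      using u both[OF l] lt by (intro T_increment_mono[OF l]) auto
    moreover have "T (c l - y l) \<le> T (c l - (y l + u))"
      using u both[OF l] lt by (intro T_le[OF l]) auto
    ultimately have "fhat i l * (T (c l - (y l + u)) - T (c l - y l)) \<le>
        (x l - u) * (T (c l - x l) - T (c l - (x l - u)))"
      using u both[OF l] fi[OF l] by (intro mult_mono) auto
    moreover have "u * T (c l - (y l + u)) \<le> u * T (c l - x l)"
      using u both[OF l] lt by (intro mult_left_mono T_le[OF l]) auto
    moreover have eqs: "y l - d l = y l + u" "z l = x l - u" "h l = fhat i l + u"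
      by (auto simp: u_def z_def h_def)
    ultimately show ?thesis unfolding eqs by (simp add: algebra_simps)
  next
    assume "d l = 0"
    then show ?thesis by (simp add: z_def h_def)
  qed
  then have "(\<Sum>l=1..L. z l * T (c l - z l) - x l * T (c l - x l)) \<le>
      (\<Sum>l=1..L. fhat i l * T (c l - y l) - h l * T (c l - (y l - d l)))"
    by (rule sum_mono)
  also have "\<dots> = real_cost fhat i - real_cost (fhat(i := h)) i"
    unfolding real_cost_def tot_h by (simp add: sum_subtractf y_def)
  also have "\<dots> \<le> 0" using dev by simp
  finally have le: "total_cost z \<le> total_cost x"
    by (simp add: total_cost_def sum_subtractf)
  have "finite_totals z"
    unfolding finite_totals_def
  proof (intro conjI ballI)
    show "(\<Sum>l=1..L. z l) = r 1 + r 2"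
      using sum_d x by (simp add: z_def sum.distrib finite_totals_def)
    fix l assume l: "l \<in> {1..L}"
    show "0 \<le> z l" "z l < c l \<or> z l = 0"
      using cases[OF l] both[OF l] fi[OF l] unfolding z_def by (elim disjE conjE; linarith)+
  qed
  moreover have "fhat i l \<le> z l" "min (x l) (tot fhat l) \<le> z l" if l: "l \<in> {1..L}" for l
    using cases[OF l] both[OF l] fi[OF l] unfolding z_def y_def[symmetric] by (elim disjE conjE; linarith)+
  ultimately show ?thesis using le by blast
qed

text \<open>User \<open>j\<close> stays and user \<open>i\<close> routes the rest of
  \<open>x\<close>. The deviation cannot bring user \<open>i\<close> below the equilibrium cost, so
  at most the remainder of \<open>total_cost x\<close> falls on user \<open>j\<close>.\<close>

lemma deviation_to_totals:
  assumes x: "finite_totals x" and ij: "(i, j) \<in> {(1, 2), (2, 1)}"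
    and le: "\<And>l. l \<in> {1..L} \<Longrightarrow> fhat j l \<le> x l"
  defines "f \<equiv> fhat(i := \<lambda>l. x l - fhat j l)"
  shows "feasible L r f" "tot f = x" "real_cost f j \<le> total_cost x - real_cost fhat i"
proof -
  have i: "i \<in> {1,2}" and j: "j \<in> {1,2}" using ij by auto
  show tot_f: "tot f = x" using ij by (auto simp: f_def tot_def)
  have "strategy L r i (\<lambda>l. x l - fhat j l)"
    using le x feasible_sum[OF fhat_feasible j] ij by (auto simp: strategy_def sum_subtractf finite_totals_def)
  moreover have "finite_totals (tot (fhat(i := \<lambda>l. x l - fhat j l)))"
    using x tot_f by (simp add: f_def)
  ultimately have *: "feasible L r f" "real_cost fhat i \<le> real_cost f i"
    unfolding f_def using fhat_deviation[OF i] by blast+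
  show "feasible L r f" by fact
  have "real_cost f i + real_cost f j = total_cost x"
    using real_cost_add[of f] tot_f ij by auto
  then show "real_cost f j \<le> total_cost x - real_cost fhat i" using *(2) by simp
qed

text \<open>This supplies the competitor for the NBS: each user saves at least half of the surplus
  of \<open>x\<close> over the equilibrium.\<close>

lemma equal_surplus_profile:
  assumes x: "finite_totals x" and le: "total_cost x \<le> total_cost (tot fhat)"
  obtains f where "feasible L r f" "finite_totals (tot f)"
    "\<And>i. i \<in> {1,2} \<Longrightarrow> real_cost f i \<le> real_cost fhat i - (total_cost (tot fhat) - total_cost x) / 2"
proof -
  have users: "1 \<in> {1, 2::nat}" "2 \<in> {1, 2::nat}" by auto
  obtain z1 where z1: "finite_totals z1" "total_cost z1 \<le> total_cost x"
    "\<And>l. l \<in> {1..L} \<Longrightarrow> fhat 1 l \<le> z1 l"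
    using raise_totals_to_fhat[OF x users(1)] by blast
  obtain z where z: "finite_totals z" "total_cost z \<le> total_cost z1"
    "\<And>l. l \<in> {1..L} \<Longrightarrow> fhat 2 l \<le> z l" "\<And>l. l \<in> {1..L} \<Longrightarrow> min (z1 l) (tot fhat l) \<le> z l"
    using raise_totals_to_fhat[OF z1(1) users(2)] by blast
  have z': "fhat 1 l \<le> z l" if "l \<in> {1..L}" for l
    using z(4)[OF that] z1(3)[OF that] feasible_le_tot[OF fhat_feasible _ that, of 1] by simp
  define f1 where "f1 = fhat(2 := \<lambda>l. z l - fhat 1 l)"
  define f2 where "f2 = fhat(1 := \<lambda>l. z l - fhat 2 l)"
  note f1 = deviation_to_totals[OF z(1), of 2 1, folded f1_def, OF _ z', simplified]
  note f2 = deviation_to_totals[OF z(1), of 1 2, folded f2_def, OF _ z(3), simplified]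
  define Jh where "Jh = real_cost fhat"
  define X where "X = total_cost z"
  have Jh: "Jh 1 + Jh 2 = total_cost (tot fhat)" unfolding Jh_def by (rule real_cost_add)
  have sums: "real_cost f1 1 + real_cost f1 2 = X" "real_cost f2 1 + real_cost f2 2 = X"
    using real_cost_add[of f1] real_cost_add[of f2] f1(2) f2(2) by (auto simp: X_def)
  \<comment> \<open>The cost of user 1 when the surplus \<open>Jh 1 + Jh 2 - X\<close> is halved. It
    lies between the costs in \<open>f1\<close>, where user 1 gets at least all of the surplus, and
    in \<open>f2\<close>, where user 2 does.\<close>
  define v where "v = (Jh 1 - Jh 2 + X) / 2"
  have XJ: "X \<le> Jh 1 + Jh 2" using z(2) z1(2) le Jh by (simp add: X_def)
  have v: "real_cost f1 1 \<le> v" "v \<le> real_cost f2 1"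
    using f1(3) f2(3) sums XJ by (simp_all add: v_def Jh_def X_def)
  obtain t where t: "0 \<le> t" "t \<le> 1" "v = (1 - t) * real_cost f1 1 + t * real_cost f2 1"
  proof (cases "real_cost f1 1 = real_cost f2 1")
    case True
    then show ?thesis using that[of 0] v by simp
  next
    case False
    define t where "t = (v - real_cost f1 1) / (real_cost f2 1 - real_cost f1 1)"
    have "t * (real_cost f2 1 - real_cost f1 1) = v - real_cost f1 1" using False by (simp add: t_def)
    then have "v = (1 - t) * real_cost f1 1 + t * real_cost f2 1" by (simp add: algebra_simps)
    moreover have "0 \<le> t" "t \<le> 1" using v False by (auto simp: t_def divide_simps)
    ultimately show ?thesis using that by blast
  qed
  \<comment> \<open>Both profiles have totals \<open>z\<close>, so their average is a single profile
    with the interpolated costs.\<close>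
  define p fs where "p m = (if m = 0 then 1 - t else t)" and "fs m = (if m = 0 then f1 else f2)" for m :: nat
  define f where "f = (\<lambda>i l. \<Sum>m<2::nat. p m * fs m i l)"
  have avg: "feasible L r f" "\<And>l. l \<in> {1..L} \<Longrightarrow> tot f l = z l"
    "\<And>i. real_cost f i = (1 - t) * real_cost f1 i + t * real_cost f2 i"
    unfolding f_def using average_profile[of 2 p fs z] t(1,2) f1(1,2) f2(1,2)
    by (simp_all add: numeral_2_eq_2 p_def fs_def)
  have cost1: "real_cost f 1 = v" using avg(3)[of 1] t(3) by simp
  have "total_cost (tot f) = X" unfolding X_def using avg(2) by (intro total_cost_cong)
  then have cost2: "real_cost f 2 = X - v" using real_cost_add[of f] cost1 by simp
  have "X \<le> total_cost x" using z(2) z1(2) by (simp add: X_def)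
  then have "real_cost f i \<le> real_cost fhat i - (total_cost (tot fhat) - total_cost x) / 2"
    if "i \<in> {1,2}" for i
    using that cost1 cost2 unfolding v_def Jh[symmetric] Jh_def by (auto simp: field_simps)
  moreover have "finite_totals (tot f)" using z(1) avg(2) by (simp add: finite_totals_def)
  ultimately show ?thesis using that avg(1) by blast
qed

section \<open>The bargaining set and the Nash solution\<close>

lemma cost_in_bargset:
  assumes "feasible L r f"
  shows "cost L c T f \<in> bargset L r c T"
  unfolding bargset_def mem_Collect_eq
proof (rule exI[of _ 1], rule exI[of _ "\<lambda>_. 1"], rule exI[of _ "\<lambda>_. f"], intro conjI)
  show "cost L c T f = (\<lambda>i. \<Sum>m<1::nat. ereal 1 * cost L c T f i)"
    by (simp add: one_ereal_def[symmetric])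
qed (use assms in simp_all)

text \<open>All weights are positive, so one infinite cost in the support would make the mixture
  infinite.\<close>

lemma bargset_finite:
  assumes g: "g \<in> bargset L r c T" and fin: "g 1 \<noteq> \<infinity>" "g 2 \<noteq> \<infinity>"
  shows "\<exists>(M::nat) p fs. 0 < M \<and> (\<Sum>m<M. p m) = 1 \<and>
    (\<forall>m<M. 0 < p m \<and> feasible L r (fs m) \<and> finite_totals (tot (fs m))) \<and>
    (\<forall>i\<in>{1,2}. g i = ereal (\<Sum>m<M. p m * real_cost (fs m) i))"
proof -
  obtain M :: nat and p :: "nat \<Rightarrow> real" and fs :: "nat \<Rightarrow> nat \<Rightarrow> nat \<Rightarrow> real" where
    M: "M \<ge> 1" and m: "\<And>m. m < M \<Longrightarrow> p m > 0 \<and> feasible L r (fs m)" and p: "(\<Sum>m<M. p m) = 1"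
    and g_eq: "g = (\<lambda>i. \<Sum>m<M. ereal (p m) * cost L c T (fs m) i)"
    using g unfolding bargset_def by blast
  have "cost L c T (fs k) i \<noteq> \<infinity>" if "k < M" "i \<in> {1,2}" for k i
  proof
    assume "cost L c T (fs k) i = \<infinity>"
    then have "ereal (p k) * cost L c T (fs k) i = \<infinity>" using m[OF that(1)] by simp
    then have "g i = \<infinity>" using that(1) unfolding g_eq by (auto simp: sum_Pinfty)
    then show False using fin that(2) by auto
  qed
  then have fin_m: "finite_totals (tot (fs k))" if "k < M" for k
    using finite_totals_iff m that by simp
  have "g i = ereal (\<Sum>m<M. p m * real_cost (fs m) i)" if "i \<in> {1,2}" for i
    using cost_eq_real_cost[OF _ fin_m that] m unfolding g_eq by simp
  then show ?thesis using m p M fin_m by (intro exI[of _ M] exI[of _ p] exI[of _ fs]) auto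
qed

text \<open>If \<open>x\<close> is no costlier than the equilibrium, the equal-surplus profile has
  Nash product at least \<open>(s / 2) * (s / 2)\<close>; the NBS does no worse, and AM-GM bounds
  its total gain by \<open>s\<close> from below. Otherwise
  \<open>g i \<le> cost L c T fhat i\<close> suffices.\<close>

lemma NBS_sum_le_sys_cost:
  assumes NBS: "is_NBS (bargset L r c T) (cost L c T fhat) g"
    and g: "g 1 = ereal a" "g 2 = ereal b" and x: "finite_totals x"
  shows "a + b \<le> total_cost x"
proof -
  note hat = cost_eq_real_cost[OF fhat_feasible fhat_finite]
  have ab: "a \<le> real_cost fhat 1" "b \<le> real_cost fhat 2"
    using NBS g hat[of 1] hat[of 2] by (auto simp: is_NBS_def)
  have sum: "real_cost fhat 1 + real_cost fhat 2 = total_cost (tot fhat)" by (rule real_cost_add)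
  show ?thesis
  proof (cases "total_cost x \<le> total_cost (tot fhat)")
    case True
    define s where "s = total_cost (tot fhat) - total_cost x"
    have s: "0 \<le> s" using True by (simp add: s_def)
    obtain f where f: "feasible L r f" "finite_totals (tot f)"
      "\<And>i. i \<in> {1,2} \<Longrightarrow> real_cost f i \<le> real_cost fhat i - s / 2"
      using equal_surplus_profile[OF x True] unfolding s_def by blast
    note cost_f = cost_eq_real_cost[OF f(1,2)]
    have le: "\<forall>i\<in>{1,2}. cost L c T f i \<le> cost L c T fhat i"
      using cost_f hat f(3)[of 1] f(3)[of 2] s by auto
    then have "(cost L c T fhat 1 - cost L c T f 1) * (cost L c T fhat 2 - cost L c T f 2)
      \<le> (cost L c T fhat 1 - g 1) * (cost L c T fhat 2 - g 2)"
      using NBS cost_in_bargset[OF f(1)] unfolding is_NBS_def by blast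
    then have "(real_cost fhat 1 - real_cost f 1) * (real_cost fhat 2 - real_cost f 2)
      \<le> (real_cost fhat 1 - a) * (real_cost fhat 2 - b)"
      using g hat cost_f by simp
    moreover have "(s / 2) * (s / 2) \<le> (real_cost fhat 1 - real_cost f 1) * (real_cost fhat 2 - real_cost f 2)"
      using f(3)[of 1] f(3)[of 2] s by (intro mult_mono) auto
    ultimately have "s \<le> (real_cost fhat 1 - a) + (real_cost fhat 2 - b)"
      using ab by (intro amgm_half) auto
    then show ?thesis using sum by (simp add: s_def)
  qed (use ab sum in linarith)
qed

text \<open>\<open>G 1 + G 2\<close> is the weighted average of the social costs in the support and
  also a lower bound for all of them, so each profile attains it and is optimal.\<close>

lemma NBS_is_optimal_profile:
  assumes NBS: "is_NBS (bargset L r c T) (cost L c T fhat) g"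
  obtains f where "is_sys_opt L r c T f" "finite_totals (tot f)"
    "g 1 = cost L c T f 1" "g 2 = cost L c T f 2"
proof -
  have le: "g i \<le> cost L c T fhat i" if "i \<in> {1,2}" for i
    using NBS that by (auto simp: is_NBS_def)
  have fin: "g 1 \<noteq> \<infinity>" "g 2 \<noteq> \<infinity>"
    using le[of 1] le[of 2] cost_eq_real_cost[OF fhat_feasible fhat_finite] by auto
  have "g \<in> bargset L r c T" using NBS by (simp add: is_NBS_def)
  from bargset_finite[OF this fin] obtain M :: nat and p and fs where
    p: "\<And>m. m < M \<Longrightarrow> 0 < p m" "(\<Sum>m<M. p m) = 1" "0 < M"
    and fs: "\<And>m. m < M \<Longrightarrow> feasible L r (fs m)" "\<And>m. m < M \<Longrightarrow> finite_totals (tot (fs m))"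
    and g: "\<And>i. i \<in> {1,2} \<Longrightarrow> g i = ereal (\<Sum>m<M. p m * real_cost (fs m) i)"
    by blast
  define G where "G i = (\<Sum>m<M. p m * real_cost (fs m) i)" for i
  have G: "g 1 = ereal (G 1)" "g 2 = ereal (G 2)" using g by (auto simp: G_def)
  note bound = NBS_sum_le_sys_cost[OF NBS G]
  have G_sum: "(\<Sum>m<M. p m * total_cost (tot (fs m))) = G 1 + G 2"
    by (simp only: G_def sum.distrib[symmetric] distrib_left[symmetric] real_cost_add)
  have opt_of_cost: "is_sys_opt L r c T f"
    if f: "feasible L r f" "finite_totals (tot f)" "total_cost (tot f) = G 1 + G 2" for f
    unfolding is_sys_opt_def
  proof (intro conjI allI impI)
    fix h assume h: "feasible L r h"
    show "sys_cost L c T f \<le> sys_cost L c T h"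
      using bound sys_cost_eq_total_cost[OF f(1,2)] f(3) sys_cost_eq_total_cost[OF h] sys_cost_infinite[OF h]
      by (cases "finite_totals (tot h)") auto
  qed (rule f)
  have opt: "is_sys_opt L r c T (fs m)" if m: "m < M" for m
    using weighted_average_eq_lower_bound[OF p(1,2) bound[OF fs(2)] G_sum m] opt_of_cost fs m by blast
  have same: "tot (fs m) l = tot (fs 0) l" if "m < M" "l \<in> {1..L}" for m l
    using is_sys_opt_tot_unique[OF opt fs(2) opt] that p(3) by blast
  \<comment> \<open>All profiles in the support share their totals, so averaging them keeps these
    totals and reproduces the costs of the mixture.\<close>
  define f where "f = (\<lambda>i l. \<Sum>m<M. p m * fs m i l)"
  have f: "feasible L r f" "\<And>l. l \<in> {1..L} \<Longrightarrow> tot f l = tot (fs 0) l"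
    "\<And>i. real_cost f i = (\<Sum>m<M. p m * real_cost (fs m) i)"
    unfolding f_def
    using average_profile[of M p fs "tot (fs 0)", OF less_imp_le[OF p(1)] p(2) fs(1) same] by blast+
  have fin_f: "finite_totals (tot f)"
    using fs(2)[OF p(3)] f(2) by (simp add: finite_totals_def)
  have "total_cost (tot f) = G 1 + G 2"
    using real_cost_add[of f] f(3) by (simp add: G_def)
  then have "is_sys_opt L r c T f" using opt_of_cost f(1) fin_f by blast
  moreover have "g i = cost L c T f i" if "i \<in> {1,2}" for i
    using g[OF that] cost_eq_real_cost[OF f(1) fin_f that] f(3) by simp
  ultimately show ?thesis using that fin_f by blast
qed

end

theorem theorem3p2:
  fixes L :: nat and c r :: "nat \<Rightarrow> real" and T :: "real \<Rightarrow> real"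
    and fhat :: "nat \<Rightarrow> nat \<Rightarrow> real" and g :: "nat \<Rightarrow> ereal"
  assumes L_pos: "L \<ge> 1"
    and r_pos: "\<forall>i\<in>{1,2::nat}. r i > 0"
    and cap: "(\<Sum>l=1..L. c l) > r 1 + r 2"
    and T_props: "\<forall>l\<in>{1..L}.
        (\<forall>x\<in>{0..<c l}. T (c l - x) \<ge> 0) \<and>
        strict_mono_on {0..<c l} (\<lambda>x. T (c l - x)) \<and>
        convex_on {0..<c l} (\<lambda>x. T (c l - x)) \<and>
        (\<exists>D. (\<forall>x\<in>{0..<c l}. ((\<lambda>y. T (c l - y)) has_real_derivative D x) (at x within {0..<c l}))
             \<and> continuous_on {0..<c l} D)"
    and NEP: "is_NEP L r c T fhat"
    and NBS: "is_NBS (bargset L r c T) (cost L c T fhat) g"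
  shows "PoS g (Jstar L r c T) = 1 \<and>
    (\<exists>fb. is_sys_opt L r c T fb \<and>
       (\<forall>fs. is_sys_opt L r c T fs \<longrightarrow> (\<forall>l\<in>{1..L}. tot fb l = tot fs l)) \<and>
       g 1 = cost L c T fb 1 \<and> g 2 = cost L c T fb 2)"
proof -
  interpret parallel_links_NEP L c r T fhat
    using r_pos cap T_props NEP by unfold_locales auto
  obtain f where f: "is_sys_opt L r c T f" "finite_totals (tot f)"
    "g 1 = cost L c T f 1" "g 2 = cost L c T f 2"
    using NBS_is_optimal_profile[OF NBS] .
  have feas: "feasible L r f" using f(1) by (simp add: is_sys_opt_def)
  have "Jstar L r c T = sys_cost L c T f"
    unfolding Jstar_def using f(1) by (intro Inf_eqI) (auto simp: is_sys_opt_def)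
  then have "PoS g (Jstar L r c T) = ereal (total_cost (tot f)) / ereal (total_cost (tot f))"
    using f sys_cost_eq_total_cost[OF feas f(2)] by (simp add: PoS_def sys_cost_def)
  \<comment> \<open>The quotient is 1 in \<open>ereal\<close> because the cost is finite and
    nonzero.\<close>
  also have "\<dots> = 1" using total_cost_pos[OF f(2)] by (simp add: one_ereal_def)
  finally show ?thesis using f is_sys_opt_tot_unique[OF f(1,2)] by blast
qed

end
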